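(* Let $k,\sigma\ge1$. Every $(k,\sigma)$-covering string has length at least $$\max\left(\binom{\sigma+k-1}{k}+k-1,\ \sigma\cdot\left\lceil \binom{\sigma+k-1}{k-1}\Big/k\right\rceil\right).$$ In particular, a $(k,\sigma)$-PdB-string can only exist if $\binom{\sigma+k-1}{k}+k-1\ \ge\ \sigma\left\lceil\binom{\sigma+k-1}{k-1}\big/k\right\rceil$.
   Context: Let $\Sigma=\{a_1<\dots<a_\sigma\}$. For a string $u$, $\mathbf{pv}(u)\in\mathbb{N}^\sigma$ has $i$-th entry the number of occurrences of $a_i$ in $u$; the order of a Parikh vector is the sum of its entries. A string $w$ over $\Sigma$ is $(k,\sigma)$-covering if for every Parikh vector $p\in\mathbb{N}^\sigma$ of order $k$ there is a substring $u$ of $w$ with $\mathbf{pv}(u)=p$. It is a $(k,\sigma)$-PdB-string (Parikh-de-Bruijn string) if for every Parikh vector $p$ of order $k$ there is exactly one (occurrence of a) length-$k$ substring $u$ of $w$ with $\mathbf{pv}(u)=p$. *)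

theory Defs
  imports Complex_Main "HOL-Library.Sublist"
begin

text \<open>
  The letters \<open>a\<^sub>1 < \<dots> < a\<^sub>\<sigma>\<close> of a finite alphabet \<open>\<Sigma>\<close> are the entries of
  \<^term>\<open>sorted_list_of_set \<Sigma>\<close>. A Parikh vector in \<open>\<nat>\<^sup>\<sigma>\<close> is a list of length
  \<^term>\<open>card \<Sigma>\<close>, indexed from 0.
\<close>

definition pv :: "'a::linorder set \<Rightarrow> 'a list \<Rightarrow> nat list" where
  "pv \<Sigma> u = map (count_list u) (sorted_list_of_set \<Sigma>)"

definition parikh_vectors :: "nat \<Rightarrow> nat \<Rightarrow> nat list set" where
  "parikh_vectors \<sigma> k = {p. length p = \<sigma> \<and> sum_list p = k}"

definition covering :: "nat \<Rightarrow> 'a::linorder set \<Rightarrow> 'a list \<Rightarrow> bool" where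
  "covering k \<Sigma> w \<longleftrightarrow> set w \<subseteq> \<Sigma> \<and>
     (\<forall>p \<in> parikh_vectors (card \<Sigma>) k. \<exists>u. sublist u w \<and> pv \<Sigma> u = p)"

text \<open>Occurrences of length-\<open>k\<close> substrings are identified with their starting positions.\<close>

definition pdb_string :: "nat \<Rightarrow> 'a::linorder set \<Rightarrow> 'a list \<Rightarrow> bool" where
  "pdb_string k \<Sigma> w \<longleftrightarrow> set w \<subseteq> \<Sigma> \<and>
     (\<forall>p \<in> parikh_vectors (card \<Sigma>) k.
        \<exists>!i. i + k \<le> length w \<and> pv \<Sigma> (take k (drop i w)) = p)"

end

theory Submission
  imports Defs
begin

text \<open>
  Every Parikh vector of order \<open>k\<close> is the vector of some length-\<open>k\<close> window of a covering
  string, and there are \<open>n - k + 1\<close> windows; this is the first bound. For the second, fix a letter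
  \<open>a\<close>. Summed over all Parikh vectors of order \<open>k\<close>, the \<open>a\<close>-entries add up to
  \<open>\<sigma> + k - 1\<close> choose \<open>k - 1\<close>, while an occurrence of \<open>a\<close> in the string lies in at most \<open>k\<close>
  windows. Hence each of the \<open>\<sigma>\<close> letters occurs at least (\<open>\<sigma> + k - 1\<close> choose \<open>k - 1\<close>)\<open> / k\<close>
  times. A PdB-string is a covering string whose windows are in bijection with the Parikh vectors,
  so it attains the first bound.
\<close>

lemma card_parikh_vectors: "card (parikh_vectors \<sigma> k) = (\<sigma> + k - 1) choose k"
  using card_length_sum_list[of \<sigma> k] by (simp add: parikh_vectors_def add.commute)

lemma finite_parikh_vectors: "finite (parikh_vectors \<sigma> k)"
proof (rule finite_subset)
  show "parikh_vectors \<sigma> k \<subseteq> {p. set p \<subseteq> {..k} \<and> length p = \<sigma>}"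
    using member_le_sum_list by (fastforce simp: parikh_vectors_def)
qed (simp add: finite_lists_length_eq)

lemma parikh_vectors_nonempty: "\<sigma> \<ge> 1 \<Longrightarrow> parikh_vectors \<sigma> k \<noteq> {}"
  by (auto simp: parikh_vectors_def sum_list_replicate
      intro!: exI[of _ "k # replicate (\<sigma> - 1) 0"])

text \<open>Phrased additively because subtraction on \<open>nat\<close> truncates.\<close>

lemma sum_list_list_update_nat:
  fixes p :: "nat list"
  assumes "i < length p"
  shows "sum_list (p[i := x]) + p ! i = sum_list p + x"
  using assms by (induction p arbitrary: i) (auto split: nat.split simp: nth_Cons)

text \<open>Vectors with entry \<open>i\<close> equal to 0 contribute nothing; on the others,
  lowering entry \<open>i\<close> by one is a bijection onto the vectors of order
  \<open>k\<close>.\<close>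

lemma sum_parikh_vectors_Suc:
  assumes "i < \<sigma>"
  shows "(\<Sum>p\<in>parikh_vectors \<sigma> (Suc k). p ! i) = (\<Sum>q\<in>parikh_vectors \<sigma> k. Suc (q ! i))"
proof -
  let ?Q = "{p \<in> parikh_vectors \<sigma> (Suc k). p ! i \<noteq> 0}"
  have "(\<Sum>p\<in>parikh_vectors \<sigma> (Suc k). p ! i) = (\<Sum>p\<in>?Q. p ! i)"
    by (rule sum.mono_neutral_right) (auto simp: finite_parikh_vectors)
  also have "\<dots> = (\<Sum>q\<in>parikh_vectors \<sigma> k. Suc (q ! i))"
  proof (rule sum.reindex_bij_witness)
    fix p assume p: "p \<in> ?Q"
    then have "sum_list (p[i := p ! i - 1]) = k"
      using sum_list_list_update_nat[of i p "p ! i - 1"] assms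
      by (simp add: parikh_vectors_def)
    then show "p[i := p ! i - 1] \<in> parikh_vectors \<sigma> k"
      using p by (simp add: parikh_vectors_def)
    show "(p[i := p ! i - 1])[i := Suc ((p[i := p ! i - 1]) ! i)] = p"
      and "Suc ((p[i := p ! i - 1]) ! i) = p ! i"
      using p assms by (auto simp: parikh_vectors_def)
  next
    fix q assume q: "q \<in> parikh_vectors \<sigma> k"
    show "q[i := Suc (q ! i)] \<in> ?Q"
      using sum_list_list_update_nat[of i q "Suc (q ! i)"] assms q
      by (simp add: parikh_vectors_def)
    show "(q[i := Suc (q ! i)])[i := (q[i := Suc (q ! i)]) ! i - 1] = q"
      using assms q by (simp add: parikh_vectors_def)
  qed
  finally show ?thesis .
qed

lemma sum_nth_parikh_vectors:
  assumes "i < \<sigma>"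
  shows "(\<Sum>p\<in>parikh_vectors \<sigma> (Suc k). p ! i) = (\<sigma> + k) choose k"
proof (induction k)
  case 0
  have "p ! i = 0" if "p \<in> parikh_vectors \<sigma> 0" for p
    using that assms by (simp add: parikh_vectors_def)
  then show ?case
    by (simp add: sum_parikh_vectors_Suc[OF assms] card_parikh_vectors)
next
  case (Suc k)
  \<comment> \<open>By the recursion, the new sum is the previous one plus the number of vectors of
    order \<open>Suc k\<close>, that is, \<open>(\<sigma> + k) choose k\<close> plus
    \<open>(\<sigma> + k) choose Suc k\<close>; Pascal's rule finishes.\<close>
  show ?case
    by (subst sum_parikh_vectors_Suc[OF assms])
      (simp add: sum_Suc Suc card_parikh_vectors)
qed

lemma sum_list_pv:
  assumes "finite \<Sigma>" and "set u \<subseteq> \<Sigma>"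
  shows "sum_list (pv \<Sigma> u) = length u"
  using assms sum_count_set[of u \<Sigma>]
  by (simp add: pv_def sum_list_distinct_conv_sum_set)

lemma length_pv: "length (pv \<Sigma> u) = card \<Sigma>"
  by (simp add: pv_def)

lemma window_in_parikh_vectors:
  assumes "finite \<Sigma>" and "set w \<subseteq> \<Sigma>" and "i + k \<le> length w"
  shows "pv \<Sigma> (take k (drop i w)) \<in> parikh_vectors (card \<Sigma>) k"
proof -
  have "set (take k (drop i w)) \<subseteq> \<Sigma>"
    using assms(2) set_take_subset set_drop_subset by (metis subset_trans)
  then show ?thesis
    using assms by (simp add: parikh_vectors_def length_pv sum_list_pv)
qed

text \<open>The definition of \<open>covering\<close> does not fix the length of the substring. It
  must be \<open>k\<close>, since all letters lie in \<open>\<Sigma>\<close> and so the entries of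
  the Parikh vector add up to the length.\<close>

lemma covering_window:
  assumes "finite \<Sigma>" and "covering k \<Sigma> w" and "p \<in> parikh_vectors (card \<Sigma>) k"
  shows "\<exists>i. i + k \<le> length w \<and> pv \<Sigma> (take k (drop i w)) = p"
proof -
  obtain u ps ss where w: "w = ps @ u @ ss" and p: "pv \<Sigma> u = p"
    using assms unfolding covering_def sublist_def by blast
  have "length u = k"
    using sum_list_pv[of \<Sigma> u] assms w p by (auto simp: covering_def parikh_vectors_def)
  then show ?thesis
    using w p by (intro exI[of _ "length ps"]) auto
qed

text \<open>A double count by induction on the window length: a window of length
  \<open>Suc k\<close> at \<open>i\<close> is its first letter followed by the window of length
  \<open>k\<close> at \<open>Suc i\<close>. \<open>m\<close> is generalized because this shift needs
  one more start. Windows running past the end are merely truncated, so any \<open>m\<close> is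
  allowed.\<close>

lemma sum_count_list_windows_le:
  "(\<Sum>i<m. count_list (take k (drop i w)) a) \<le> k * count_list w a"
proof (induction k arbitrary: m)
  case (Suc k)
  \<comment> \<open>The windows of length one at starts below \<open>m\<close> spell out the prefix
    \<open>take m w\<close>.\<close>
  have single: "(\<Sum>i<m. count_list (take 1 (drop i w)) a) = count_list (take m w) a"
  proof (induction m)
    case (Suc m)
    then show ?case
      using take_add[of m 1 w] by simp
  qed simp
  have "count_list w a = count_list (take m w) a + count_list (drop m w) a"
    by (metis append_take_drop_id count_list_append)
  then have le: "(\<Sum>i<m. count_list (take 1 (drop i w)) a) \<le> count_list w a"
    using single by simp
  have "count_list (take (Suc k) (drop i w)) a =
      count_list (take 1 (drop i w)) a + count_list (take k (drop (Suc i) w)) a" for i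
    using take_add[of 1 k "drop i w"] by simp
  then have "(\<Sum>i<m. count_list (take (Suc k) (drop i w)) a) =
      (\<Sum>i<m. count_list (take 1 (drop i w)) a) + (\<Sum>i<m. count_list (take k (drop (Suc i) w)) a)"
    by (simp add: sum.distrib)
  \<comment> \<open>The left side is the right side without its term for
    \<open>i = 0\<close>.\<close>
  moreover have "(\<Sum>i<m. count_list (take k (drop (Suc i) w)) a)
      \<le> (\<Sum>i<Suc m. count_list (take k (drop i w)) a)"
    by (simp add: sum.lessThan_Suc_shift del: sum.lessThan_Suc)
  ultimately show ?case
    using le Suc[of "Suc m"] by simp
qed simp

text \<open>One start is chosen per vector. The window at a start determines its vector, so distinct
  vectors get distinct starts.\<close>

lemma covering_choose_windows:
  assumes "finite \<Sigma>" and "covering k \<Sigma> w"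
  obtains f where "\<And>p. p \<in> parikh_vectors (card \<Sigma>) k \<Longrightarrow>
      f p + k \<le> length w \<and> pv \<Sigma> (take k (drop (f p) w)) = p"
    and "inj_on f (parikh_vectors (card \<Sigma>) k)"
proof -
  obtain f where f: "\<forall>p\<in>parikh_vectors (card \<Sigma>) k.
      f p + k \<le> length w \<and> pv \<Sigma> (take k (drop (f p) w)) = p"
    using covering_window[OF assms] by metis
  moreover from f have "inj_on f (parikh_vectors (card \<Sigma>) k)"
    by (metis inj_onI)
  ultimately show ?thesis using that by blast
qed

lemma covering_length_ge_card:
  assumes "finite \<Sigma>" and "card \<Sigma> \<ge> 1" and "covering k \<Sigma> w"
  shows "((card \<Sigma> + k - 1) choose k) + k \<le> length w + 1"
proof -
  let ?P = "parikh_vectors (card \<Sigma>) k"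
  obtain f where f: "\<And>p. p \<in> ?P \<Longrightarrow> f p + k \<le> length w" and inj: "inj_on f ?P"
    using covering_choose_windows[OF assms(1,3)] by metis
  have "f ` ?P \<subseteq> {..length w - k}"
    using f by fastforce
  then have "card ?P \<le> length w - k + 1"
    using card_mono[of "{..length w - k}" "f ` ?P"] card_image[OF inj] by simp
  \<comment> \<open>Some vector exists and has a window, so \<open>length w - k\<close> above is a
    true difference.\<close>
  moreover have "k \<le> length w"
    using f parikh_vectors_nonempty[OF assms(2), of k] by fastforce
  ultimately show ?thesis
    by (simp add: card_parikh_vectors)
qed

lemma covering_count_ge:
  assumes "finite \<Sigma>" and "k \<ge> 1" and "covering k \<Sigma> w" and "a \<in> \<Sigma>"
  shows "(card \<Sigma> + k - 1) choose (k - 1) \<le> k * count_list w a"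
proof -
  let ?P = "parikh_vectors (card \<Sigma>) k"
  obtain f where f: "\<And>p. p \<in> ?P \<Longrightarrow> f p + k \<le> length w \<and> pv \<Sigma> (take k (drop (f p) w)) = p"
    and inj: "inj_on f ?P"
    using covering_choose_windows[OF assms(1,3)] by metis
  obtain i where i: "i < card \<Sigma>" "sorted_list_of_set \<Sigma> ! i = a"
    using assms(1,4) by (metis in_set_conv_nth length_sorted_list_of_set set_sorted_list_of_set)
  have "(card \<Sigma> + k - 1) choose (k - 1) = (\<Sum>p\<in>?P. p ! i)"
    using sum_nth_parikh_vectors[OF i(1), of "k - 1"] assms(2) by simp
  also have "\<dots> = (\<Sum>p\<in>?P. count_list (take k (drop (f p) w)) a)"
  proof (rule sum.cong[OF refl])
    fix p assume "p \<in> ?P"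
    then have "p = pv \<Sigma> (take k (drop (f p) w))"
      using f by simp
    then show "p ! i = count_list (take k (drop (f p) w)) a"
      using i by (metis length_sorted_list_of_set nth_map pv_def)
  qed
  also have "\<dots> = (\<Sum>j\<in>f ` ?P. count_list (take k (drop j w)) a)"
    by (simp add: sum.reindex[OF inj])
  \<comment> \<open>Passing from the chosen starts to all starts only adds nonnegative
    terms.\<close>
  also have "\<dots> \<le> (\<Sum>j<Suc (length w). count_list (take k (drop j w)) a)"
    using f by (intro sum_mono2) fastforce+
  also have "\<dots> \<le> k * count_list w a"
    by (rule sum_count_list_windows_le)
  finally show ?thesis .
qed

lemma covering_length_ge_letters:
  assumes "finite \<Sigma>" and "k \<ge> 1" and "covering k \<Sigma> w"
  shows "int (card \<Sigma>) * \<lceil>real ((card \<Sigma> + k - 1) choose (k - 1)) / real k\<rceil> \<le> int (length w)"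
proof -
  let ?c = "\<lceil>real ((card \<Sigma> + k - 1) choose (k - 1)) / real k\<rceil>"
  \<comment> \<open>Each count is an integer, so rounding up happens letter by letter, before
    summing; hence the ceiling stands inside the product with \<open>card \<Sigma>\<close>.\<close>
  have "?c \<le> int (count_list w a)" if "a \<in> \<Sigma>" for a
  proof -
    have "real ((card \<Sigma> + k - 1) choose (k - 1)) \<le> real k * real (count_list w a)"
      using covering_count_ge[OF assms that] by (metis of_nat_le_iff of_nat_mult)
    then show ?thesis
      using assms(2) by (simp add: ceiling_le_iff divide_le_eq mult.commute)
  qed
  then have "int (card \<Sigma>) * ?c \<le> (\<Sum>a\<in>\<Sigma>. int (count_list w a))"
    by (intro sum_bounded_below) simp
  also have "\<dots> = int (length w)"
    using sum_count_set[of w \<Sigma>] assms by (simp add: covering_def flip: of_nat_sum)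
  finally show ?thesis .
qed

lemma pdb_string_imp_covering:
  assumes "pdb_string k \<Sigma> w"
  shows "covering k \<Sigma> w"
proof -
  have "sublist (take k (drop i w)) w" for i
    using sublist_take sublist_drop sublist_order.order_trans by blast
  then show ?thesis
    using assms unfolding pdb_string_def covering_def by metis
qed

text \<open>Uniqueness makes the map from starts to Parikh vectors injective, so there are at most
  as many windows as vectors.\<close>

lemma pdb_string_length_le:
  assumes "finite \<Sigma>" and "pdb_string k \<Sigma> w" and "k \<le> length w"
  shows "length w + 1 \<le> ((card \<Sigma> + k - 1) choose k) + k"
proof -
  let ?P = "parikh_vectors (card \<Sigma>) k"
  let ?g = "\<lambda>i. pv \<Sigma> (take k (drop i w))"
  have in_P: "?g i \<in> ?P" if "i \<le> length w - k" for i
    using window_in_parikh_vectors[of \<Sigma> w i k] assms that by (simp add: pdb_string_def)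
  have "inj_on ?g {..length w - k}"
  proof (rule inj_onI)
    fix i j assume "i \<in> {..length w - k}" "j \<in> {..length w - k}" "?g i = ?g j"
    moreover from this have "i + k \<le> length w" "j + k \<le> length w"
      using assms(3) by auto
    ultimately show "i = j"
      using assms(2) in_P[of i] unfolding pdb_string_def by (metis atMost_iff)
  qed
  then have "card {..length w - k} \<le> card ?P"
    using in_P by (intro card_inj_on_le) (auto simp: finite_parikh_vectors)
  then show ?thesis
    using assms(3) by (simp add: card_parikh_vectors)
qed

theorem theorem4:
  fixes k \<sigma> :: nat and \<Sigma> :: "'a::linorder set"
  assumes "k \<ge> 1" and "\<sigma> \<ge> 1" and "finite \<Sigma>" and "card \<Sigma> = \<sigma>"
  shows "(\<forall>w. covering k \<Sigma> w \<longrightarrow>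
            int (length w) \<ge>
              max (int ((\<sigma> + k - 1) choose k) + int k - 1)
                  (int \<sigma> * \<lceil>real ((\<sigma> + k - 1) choose (k - 1)) / real k\<rceil>))
       \<and> ((\<exists>w. pdb_string k \<Sigma> w) \<longrightarrow>
            int ((\<sigma> + k - 1) choose k) + int k - 1 \<ge>
              int \<sigma> * \<lceil>real ((\<sigma> + k - 1) choose (k - 1)) / real k\<rceil>)"
proof (intro conjI allI impI)
  fix w assume cov: "covering k \<Sigma> w"
  have "((\<sigma> + k - 1) choose k) + k \<le> length w + 1"
    using covering_length_ge_card[OF assms(3) _ cov] assms by simp
  moreover have "int \<sigma> * \<lceil>real ((\<sigma> + k - 1) choose (k - 1)) / real k\<rceil> \<le> int (length w)"
    using covering_length_ge_letters[OF assms(3,1) cov] assms(4) by simp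
  ultimately show "max (int ((\<sigma> + k - 1) choose k) + int k - 1)
      (int \<sigma> * \<lceil>real ((\<sigma> + k - 1) choose (k - 1)) / real k\<rceil>) \<le> int (length w)"
    by linarith
next
  assume "\<exists>w. pdb_string k \<Sigma> w"
  then obtain w where pdb: "pdb_string k \<Sigma> w" by blast
  then have cov: "covering k \<Sigma> w"
    by (rule pdb_string_imp_covering)
  \<comment> \<open>A single vector already forces a window, hence \<open>k \<le> length w\<close>.
    The length of \<open>w\<close> then lies between the two sides of the claimed
    inequality.\<close>
  obtain p where "p \<in> parikh_vectors (card \<Sigma>) k"
    using parikh_vectors_nonempty assms by blast
  then have "k \<le> length w"
    using covering_window[OF assms(3) cov] by fastforce
  then have "length w + 1 \<le> ((\<sigma> + k - 1) choose k) + k"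
    using pdb_string_length_le[OF assms(3) pdb] assms(4) by simp
  moreover have "int \<sigma> * \<lceil>real ((\<sigma> + k - 1) choose (k - 1)) / real k\<rceil> \<le> int (length w)"
    using covering_length_ge_letters[OF assms(3,1) cov] assms(4) by simp
  ultimately show "int \<sigma> * \<lceil>real ((\<sigma> + k - 1) choose (k - 1)) / real k\<rceil>
      \<le> int ((\<sigma> + k - 1) choose k) + int k - 1"
    by linarith
qed

end
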